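(* Let $L^+:=-\Delta-2W$ and $L^-:=-\Delta-W$ on $\mathbb R^6$, where $W(x)=(1+|x|^2/24)^{-2}$. Let $\nu>0$ be a real number for which there exist nonzero real-valued radial Schwartz functions $\mathcal Y^{(1)},\mathcal Y^{(2)}$ on $\mathbb R^6$ with $$L^+\mathcal Y^{(1)}=-\nu\mathcal Y^{(2)},\qquad L^-\mathcal Y^{(2)}=\nu\mathcal Y^{(1)}.$$ Then $\nu\le\frac14$.
   Context: $W$ satisfies $-\Delta W=W^2$ on $\mathbb R^6$, so $L^-W=0$. The existence of such $\nu,\mathcal Y^{(1)},\mathcal Y^{(2)}$ is known. *)

theory Defs
  imports "HOL-Analysis.Analysis"
begin

definition partial_deriv :: "'a::euclidean_space \<Rightarrow> ('a \<Rightarrow> real) \<Rightarrow> 'a \<Rightarrow> real" where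
  "partial_deriv b f x = deriv (\<lambda>t. f (x + t *\<^sub>R b)) 0"

text \<open>A multi-index is encoded as a list of standard basis vectors.\<close>

fun iter_partial :: "'a::euclidean_space list \<Rightarrow> ('a \<Rightarrow> real) \<Rightarrow> 'a \<Rightarrow> real" where
  "iter_partial [] f = f"
| "iter_partial (b # bs) f = partial_deriv b (iter_partial bs f)"

text \<open>Here \<open>differentiable\<close> is Frechet differentiability; since it is required of all
  iterated partial derivatives, they are all continuous, and this is the usual class of
  infinitely differentiable functions.\<close>

definition smooth :: "('a::euclidean_space \<Rightarrow> real) \<Rightarrow> bool" where
  "smooth f \<longleftrightarrow> (\<forall>bs\<in>lists Basis. \<forall>x. iter_partial bs f differentiable (at x))"

definition schwartz :: "('a::euclidean_space \<Rightarrow> real) \<Rightarrow> bool" where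
  "schwartz f \<longleftrightarrow> smooth f \<and>
    (\<forall>k::nat. \<forall>bs\<in>lists Basis. \<exists>C. \<forall>x. norm x ^ k * \<bar>iter_partial bs f x\<bar> \<le> C)"

definition radial :: "('a::euclidean_space \<Rightarrow> real) \<Rightarrow> bool" where
  "radial f \<longleftrightarrow> (\<forall>x y. norm x = norm y \<longrightarrow> f x = f y)"

definition laplacian :: "('a::euclidean_space \<Rightarrow> real) \<Rightarrow> 'a \<Rightarrow> real" where
  "laplacian f x = (\<Sum>b\<in>Basis. partial_deriv b (partial_deriv b f) x)"

definition W :: "real ^ 6 \<Rightarrow> real" where
  "W x = 1 / (1 + (norm x)\<^sup>2 / 24)\<^sup>2"

definition Lplus :: "(real ^ 6 \<Rightarrow> real) \<Rightarrow> real ^ 6 \<Rightarrow> real" where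
  "Lplus f x = - laplacian f x - 2 * W x * f x"

definition Lminus :: "(real ^ 6 \<Rightarrow> real) \<Rightarrow> real ^ 6 \<Rightarrow> real" where
  "Lminus f x = - laplacian f x - W x * f x"

end

theory Submission
  imports Defs "HOL-Real_Asymp.Real_Asymp"
begin

text \<open>
  Since \<open>W\<close> is a positive solution of \<open>L\<^sup>- W = 0\<close>, the operator \<open>L\<^sup>-\<close> factorises as \<open>D\<^sup>* D\<close> with
  \<open>D = \<partial>\<^sub>r - W'/W\<close>. Adding the energy identities of both equations gives
  \<open>\<integral> (D y)\<^sup>2 + (D z)\<^sup>2 = \<integral> W y\<^sup>2\<close> for the radial profiles \<open>y\<close>, \<open>z\<close> of the two functions. The quantity
  \<open>H = D z / \<nu>\<close> satisfies \<open>D\<^sup>* H = y\<close>, a first-order equation, so that a suitable quadratic form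
  in \<open>(y, H)\<close> can be added to the integrand as a null Lagrangian. The integrand then becomes a square
  plus \<open>(\<nu>\<^sup>2 - c(r)) H\<^sup>2\<close> with \<open>c \<le> 64/2187 < 1/16\<close>. If \<open>\<nu> > 1/4\<close>, this forces \<open>H = 0\<close>, hence \<open>y = 0\<close>.
\<close>

section \<open>The radial system\<close>

text \<open>The square root of the profile of \<open>W\<close>. It makes the coefficients polynomial
  in \<open>r\<close> and \<open>w r\<close>; in particular W'/W = - r w / 6.\<close>

definition w :: "real \<Rightarrow> real" where
  "w r = 1 / (1 + r\<^sup>2 / 24)"

lemma w_pos: "w r > 0"
  unfolding w_def by (simp add: add_pos_nonneg)

lemma square_times_w: "r\<^sup>2 * w r = 24 * (1 - w r)"
proof -
  have "24 + r\<^sup>2 \<noteq> 0" by (smt (verit) zero_le_power2)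
  then show ?thesis unfolding w_def by (simp add: field_simps)
qed

lemma w_has_derivative: "(w has_real_derivative - (r * (w r)\<^sup>2 / 12)) (at r)"
proof -
  have "1 + r\<^sup>2 / 24 \<noteq> 0" by (smt (verit) zero_le_power2 divide_nonneg_nonneg)
  then show ?thesis
    unfolding w_def
    by (auto intro!: derivative_eq_intros simp: power2_eq_square)
qed

text \<open>For x > 0 the cubic 6 x^3 - 4 x^2 is minimal at x = 4/9, hence the double root in the
  factorisation. The minimum is -64/243, and 64/2187 < 1/16.\<close>

lemma cubic_in_w_bound:
  fixes x :: real
  assumes "0 < x"
  shows "0 < 1 / 16 + x\<^sup>2 * (6 * x - 4) / 9"
proof -
  have "0 \<le> (x - 4/9)\<^sup>2 * (6 * x + 4/3)"
    using assms by simp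
  also have "\<dots> = 6 * x ^ 3 - 4 * x\<^sup>2 + 64/243"
    by (simp add: power2_eq_square power3_eq_cube algebra_simps)
  finally show ?thesis
    by (simp add: power2_eq_square power3_eq_cube field_simps)
qed

lemma power_times_tendsto_0:
  fixes f :: "real \<Rightarrow> real"
  assumes "\<And>k. \<exists>C. \<forall>r>0. r ^ k * \<bar>f r\<bar> \<le> C"
  shows "((\<lambda>r. r ^ k * f r) \<longlongrightarrow> 0) at_top"
proof -
  obtain C where C: "\<And>r. r > 0 \<Longrightarrow> r ^ Suc k * \<bar>f r\<bar> \<le> C"
    using assms by blast
  show ?thesis
  proof (rule Lim_null_comparison)
    show "\<forall>\<^sub>F r in at_top. norm (r ^ k * f r) \<le> C / r"
      using eventually_gt_at_top[of "0::real"]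
      by eventually_elim (use C in \<open>auto simp: abs_mult field_simps\<close>)
    show "((\<lambda>r. C / r) \<longlongrightarrow> 0) at_top"
      by real_asymp
  qed
qed

lemma decaying_radial_solution_zero:
  fixes y y1 y2 z z1 z2 :: "real \<Rightarrow> real" and \<nu> :: real
  assumes \<nu>: "\<nu> > 1 / 4"
    and dy: "\<And>r. (y has_real_derivative y1 r) (at r)"
    and dy1: "\<And>r. (y1 has_real_derivative y2 r) (at r)"
    and dz: "\<And>r. (z has_real_derivative z1 r) (at r)"
    and dz1: "\<And>r. (z1 has_real_derivative z2 r) (at r)"
    and decay: "\<And>f k. f \<in> {y, y1, z, z1} \<Longrightarrow> \<exists>C. \<forall>r>0. r ^ k * \<bar>f r\<bar> \<le> C"
    and ode_y: "\<And>r. r > 0 \<Longrightarrow> - (y2 r + 5 / r * y1 r) - 2 * (w r)\<^sup>2 * y r = - \<nu> * z r"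
    and ode_z: "\<And>r. r > 0 \<Longrightarrow> - (z2 r + 5 / r * z1 r) - (w r)\<^sup>2 * z r = \<nu> * y r"
    and "r > 0"
  shows "y r = 0"
proof -
  define H where "H r = (z1 r + r * w r / 6 * z r) / \<nu>" for r
  define \<Psi> where "\<Psi> r = y r * y1 r + r * w r / 3 * (y r)\<^sup>2 + \<nu> * z r * H r
      - 4 / 3 * w r * (1 - w r) * y r * H r
      + r * (w r)\<^sup>2 * (3 - 4 * w r) / 18 * (H r)\<^sup>2" for r
  define \<Phi> where "\<Phi> r = r ^ 5 * \<Psi> r" for r
  define R where "R r = r ^ 5 * ((y1 r + r * w r / 3 * y r - 2 / 3 * w r * (1 - w r) * H r)\<^sup>2
      + (\<nu>\<^sup>2 + (w r)\<^sup>2 * (6 * w r - 4) / 9) * (H r)\<^sup>2)" for r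
  \<comment> \<open>\<open>\<Phi>\<close> is the boundary term of the integrated identity and \<open>R\<close> the completed integrand; the
    coefficients \<open>p\<close>, \<open>2 q\<close>, \<open>s\<close> of \<open>y\<^sup>2\<close>, \<open>y H\<close>, \<open>H\<^sup>2\<close> in the null Lagrangian come from taking
    \<open>p = - W'/W\<close> and then choosing \<open>q\<close> and \<open>s\<close> so that the remainder has no \<open>y\<^sup>2\<close> and \<open>y H\<close> terms.\<close>
  have z1_eq: "z1 r = \<nu> * H r - r * w r / 6 * z r" for r
    using \<nu> by (simp add: H_def)
  have dH: "(H has_real_derivative - y r - (5 / r - r * w r / 6) * H r) (at r)" if "r > 0" for r
  proof -
    have "((\<lambda>r. r * w r / 6) has_real_derivative w r / 6 - r\<^sup>2 * (w r)\<^sup>2 / 72) (at r)"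
      by (rule DERIV_cong[OF DERIV_cdivide[OF DERIV_mult[OF DERIV_ident w_has_derivative]]])
        (simp add: field_simps power2_eq_square)
    from DERIV_cdivide[OF DERIV_add[OF dz1[of r] DERIV_mult[OF this dz[of r]]], of \<nu>]
    have "(H has_real_derivative (z2 r + ((w r / 6 - r\<^sup>2 * (w r)\<^sup>2 / 72) * z r
        + z1 r * (r * w r / 6))) / \<nu>) (at r)"
      by (simp add: H_def[abs_def])
    \<comment> \<open>The terms in \<open>z r\<close> cancel: this is L^- W = 0, encoded in
      \<open>square_times_w\<close>.\<close>
    moreover have "z2 r + ((w r / 6 - r\<^sup>2 * (w r)\<^sup>2 / 72) * z r + z1 r * (r * w r / 6))
        = \<nu> * (- y r - (5 / r - r * w r / 6) * H r)"
    proof -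
      have "z2 r = - (5 / r * z1 r) - (w r)\<^sup>2 * z r - \<nu> * y r"
        using ode_z[OF that] by simp
      moreover have "5 / r * r = 5"
        using that by simp
      ultimately show ?thesis
        using z1_eq[of r] square_times_w[of r] by algebra
    qed
    ultimately show ?thesis
      using \<nu> by simp
  qed
  have d\<Phi>: "(\<Phi> has_real_derivative R r) (at r)" if "r > 0" for r
  proof -
    define i where "i = 5 / r"
    have ir: "i * r = 5"
      using that by (simp add: i_def)
    have y2: "y2 r = \<nu> * z r - 2 * (w r)\<^sup>2 * y r - i * y1 r"
      using ode_y[OF that] by (simp add: i_def)
    have dH': "(H has_real_derivative - y r - (i - r * w r / 6) * H r) (at r)"
      using dH[OF that] by (simp add: i_def)
    \<comment> \<open>The derivative of \<open>\<Psi>\<close> with \<open>y2\<close>,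
      \<open>z1\<close> and the derivative of \<open>H\<close> eliminated; not the operator D of the
      overview.\<close>
    define D where "D = (y1 r)\<^sup>2 + y r * (\<nu> * z r - 2 * (w r)\<^sup>2 * y r - i * y1 r)
      + (w r / 3 - (r * w r)\<^sup>2 / 36) * (y r)\<^sup>2 + 2 / 3 * r * w r * y r * y1 r
      + \<nu> * (\<nu> * H r - r * w r / 6 * z r) * H r
      + \<nu> * z r * (- y r - (i - r * w r / 6) * H r)
      + r * (w r)\<^sup>2 / 9 * (1 - 2 * w r) * y r * H r
      - 4 / 3 * w r * (1 - w r) * (y1 r * H r + y r * (- y r - (i - r * w r / 6) * H r))
      + ((w r)\<^sup>2 * (3 - 4 * w r) / 18 - (r * w r)\<^sup>2 * w r * (1 - 2 * w r) / 36) * (H r)\<^sup>2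
      + r * (w r)\<^sup>2 * (3 - 4 * w r) / 9 * H r * (- y r - (i - r * w r / 6) * H r)"
    have "(\<Psi> has_real_derivative D) (at r)"
      unfolding \<Psi>_def[abs_def]
      by (rule DERIV_cong,
          (rule derivative_eq_intros dy dy1 dz dH' w_has_derivative refl numeral_neq_zero)+)
        (simp add: y2 z1_eq D_def field_simps power2_eq_square)
    from DERIV_mult[OF DERIV_pow[of 5] this]
    have "(\<Phi> has_real_derivative 5 * r ^ 4 * \<Psi> r + r ^ 5 * D) (at r)"
      by (simp add: \<Phi>_def[abs_def] algebra_simps)
    moreover have "5 * r ^ 4 = r ^ 5 * i"
      using that by (simp add: i_def eval_nat_numeral)
    \<comment> \<open>A polynomial identity: the discrepancy is a combination, with explicit
      cofactors, of i r - 5 and r^2 w - 24 (1 - w), which both vanish.\<close>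
    moreover have "D + i * \<Psi> r
      - ((y1 r + r * w r / 3 * y r - 2 / 3 * w r * (1 - w r) * H r)\<^sup>2
        + (\<nu>\<^sup>2 + (w r)\<^sup>2 * (6 * w r - 4) / 9) * (H r)\<^sup>2)
      = (i * r - 5) * (w r / 3 * (y r)\<^sup>2 - (w r)\<^sup>2 * (3 - 4 * w r) / 18 * (H r)\<^sup>2)
        + (r\<^sup>2 * w r - 24 * (1 - w r)) * ((w r)\<^sup>2 * ((3 - 4 * w r) / 54 - (1 - 2 * w r) / 36) * (H r)\<^sup>2
          - 5 / 36 * w r * (y r)\<^sup>2)"
      unfolding D_def \<Psi>_def
      by (simp add: field_simps power2_eq_square)
    then have "D + i * \<Psi> r = (y1 r + r * w r / 3 * y r - 2 / 3 * w r * (1 - w r) * H r)\<^sup>2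
        + (\<nu>\<^sup>2 + (w r)\<^sup>2 * (6 * w r - 4) / 9) * (H r)\<^sup>2"
      by (simp add: ir square_times_w)
    then have "R r = r ^ 5 * (D + i * \<Psi> r)"
      by (simp add: R_def)
    ultimately show ?thesis
      by (simp add: distrib_left add.commute mult.assoc)
  qed
  have isCont: "isCont y r" "isCont y1 r" "isCont z r" "isCont z1 r" "isCont w r" for r
    using dy dy1 dz dz1 w_has_derivative by (blast intro: DERIV_isCont)+
  \<comment> \<open>\<open>\<Phi>\<close> contains no 1/r, so it is continuous also at 0, where the
    monotonicity argument starts.\<close>
  have cont: "continuous_on A \<Phi>" for A
    unfolding \<Phi>_def[abs_def] \<Psi>_def[abs_def] H_def[abs_def]
    by (intro continuous_at_imp_continuous_on ballI continuous_intros isCont) (use \<nu> in auto)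
  have \<Phi>_lim: "(\<Phi> \<longlongrightarrow> 0) at_top"
  proof -
    have lim: "((\<lambda>r. r ^ k * f r) \<longlongrightarrow> 0) at_top" if "f \<in> {y, y1, z, z1}" for f k
      using power_times_tendsto_0 decay[OF that] by blast
    have lim_w: "(w \<longlongrightarrow> 0) at_top" "((\<lambda>r. r * w r) \<longlongrightarrow> 0) at_top"
      unfolding w_def by real_asymp+
    have lim_H: "((\<lambda>r. r ^ k * H r) \<longlongrightarrow> 0) at_top" for k
    proof -
      have "((\<lambda>r. (r ^ k * z1 r + r * w r / 6 * (r ^ k * z r)) / \<nu>) \<longlongrightarrow> (0 + 0 / 6 * 0) / \<nu>) at_top"
        by (intro tendsto_intros lim lim_w) (use \<nu> in auto)
      then show ?thesis
        by (simp add: H_def algebra_simps)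
    qed
    \<comment> \<open>Each term is quadratic in decaying functions: one factor absorbs r^5, and r^0
      brings the other into the form of \<open>lim\<close> or \<open>lim_H\<close>.\<close>
    have "((\<lambda>r. (r ^ 5 * y r) * (r ^ 0 * y1 r) + r * w r / 3 * ((r ^ 5 * y r) * (r ^ 0 * y r))
        + \<nu> * ((r ^ 5 * z r) * (r ^ 0 * H r))
        - 4 / 3 * w r * (1 - w r) * ((r ^ 5 * y r) * (r ^ 0 * H r))
        + (r * w r) * w r * (3 - 4 * w r) / 18 * ((r ^ 5 * H r) * (r ^ 0 * H r))) \<longlongrightarrow>
        0 * 0 + 0 / 3 * (0 * 0) + \<nu> * (0 * 0) - 4 / 3 * 0 * (1 - 0) * (0 * 0)
        + 0 * 0 * (3 - 4 * 0) / 18 * (0 * 0)) at_top"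
      by (intro tendsto_intros lim lim_H lim_w) auto
    then show ?thesis
      by (simp add: \<Phi>_def[abs_def] \<Psi>_def power2_eq_square algebra_simps)
  qed
  \<comment> \<open>The threshold enters here: \<nu>^2 > 1/16 outweighs the minimum of the
    cubic.\<close>
  have c_pos: "\<nu>\<^sup>2 + (w r)\<^sup>2 * (6 * w r - 4) / 9 > 0" for r
    using cubic_in_w_bound[OF w_pos, of r] power_strict_mono[OF \<nu>, of 2]
    by (simp add: power2_eq_square)
  have R_nonneg: "R r \<ge> 0" if "r > 0" for r
    using that c_pos[of r] by (simp add: R_def)
  have mono: "\<Phi> a \<le> \<Phi> b" if "0 \<le> a" "a \<le> b" for a b
  proof (rule DERIV_nonneg_imp_increasing_open[OF \<open>a \<le> b\<close> _ cont])
    fix x assume "a < x"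
    with \<open>0 \<le> a\<close> have "x > 0" by simp
    then show "\<exists>D. (\<Phi> has_real_derivative D) (at x) \<and> 0 \<le> D"
      using d\<Phi> R_nonneg by blast
  qed
  have \<Phi>_zero: "\<Phi> r = 0" if "r > 0" for r
  proof (rule antisym)
    show "\<Phi> r \<ge> 0"
      using mono[of 0 r] that by (simp add: \<Phi>_def)
    show "\<Phi> r \<le> 0"
    proof (rule tendsto_lowerbound[OF \<Phi>_lim])
      show "\<forall>\<^sub>F s in at_top. \<Phi> r \<le> \<Phi> s"
        using eventually_ge_at_top[of r] by eventually_elim (use that in \<open>auto intro: mono\<close>)
    qed simp
  qed
  have R_zero: "R r = 0" if "r > 0" for r
  proof -
    have "(\<Phi> has_real_derivative 0) (at r)"
      by (rule has_field_derivative_transform_within_open[of "\<lambda>_. 0" _ _ "{0<..}"])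
        (use that \<Phi>_zero in auto)
    then show ?thesis
      using d\<Phi>[OF that] DERIV_unique by blast
  qed
  have H_zero: "H r = 0" if "r > 0" for r
  proof -
    have "(\<nu>\<^sup>2 + (w r)\<^sup>2 * (6 * w r - 4) / 9) * (H r)\<^sup>2 = 0"
      using R_zero[OF that] that c_pos[of r]
      by (simp add: R_def add_nonneg_eq_0_iff)
    then show ?thesis
      using c_pos[of r] by simp
  qed
  \<comment> \<open>Once \<open>H\<close> vanishes on the half-line, its first-order equation
    reduces to 0 = - y.\<close>
  have "(H has_real_derivative 0) (at r)"
    by (rule has_field_derivative_transform_within_open[of "\<lambda>_. 0" _ _ "{0<..}"])
      (use \<open>r > 0\<close> H_zero in auto)
  then show "y r = 0"
    using dH[OF \<open>r > 0\<close>] H_zero[OF \<open>r > 0\<close>] DERIV_unique by fastforce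
qed

section \<open>Restriction to a ray\<close>

text \<open>Frechet differentiability makes \<open>deriv\<close> a genuine derivative along the
  line; a shift moves the base point from 0 to \<open>t\<close>.\<close>

lemma smooth_iter_partial_has_derivative:
  assumes "smooth f" "bs \<in> lists Basis" "b \<in> Basis"
  shows "((\<lambda>t. iter_partial bs f (x + t *\<^sub>R b))
           has_real_derivative iter_partial (b # bs) f (x + t *\<^sub>R b)) (at t)"
proof -
  let ?g = "iter_partial bs f"
  have "(\<lambda>s. ?g (x + s *\<^sub>R b)) differentiable (at s)" for s
  proof -
    have "(?g \<circ> (\<lambda>s. x + s *\<^sub>R b)) differentiable (at s)"
      using assms unfolding smooth_def
      by (intro differentiable_chain_at derivative_intros) auto
    then show ?thesis by (simp add: o_def)
  qed
  then have deriv: "((\<lambda>s. ?g (x + s *\<^sub>R b)) has_real_derivative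
      deriv (\<lambda>s. ?g (x + s *\<^sub>R b)) t) (at t)"
    using DERIV_deriv_iff_real_differentiable by blast
  have "((\<lambda>s. ?g (x + s *\<^sub>R b)) has_real_derivative
      deriv (\<lambda>s. ?g (x + s *\<^sub>R b)) t) (at (0 + t))"
    using deriv by simp
  then have "((\<lambda>s. ?g (x + (s + t) *\<^sub>R b)) has_real_derivative
      deriv (\<lambda>s. ?g (x + s *\<^sub>R b)) t) (at 0)"
    by (subst (asm) DERIV_shift)
  then have "iter_partial (b # bs) f (x + t *\<^sub>R b) = deriv (\<lambda>s. ?g (x + s *\<^sub>R b)) t"
    by (simp add: partial_deriv_def DERIV_imp_deriv scaleR_add_left add_ac)
  then show ?thesis
    using deriv by simp
qed

text \<open>Each of the DIM - 1 directions orthogonal to \<open>e\<close> contributes f_e / r: along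
  such a line f depends only on \<rho>(t) = sqrt (r^2 + t^2).\<close>

lemma radial_laplacian:
  fixes f :: "'a::euclidean_space \<Rightarrow> real"
  assumes "smooth f" "radial f" and e: "e \<in> Basis" and "r > 0"
  shows "laplacian f (r *\<^sub>R e) = iter_partial [e, e] f (r *\<^sub>R e)
    + (DIM('a) - 1) / r * iter_partial [e] f (r *\<^sub>R e)"
proof -
  have tangential: "partial_deriv b (partial_deriv b f) (r *\<^sub>R e) = iter_partial [e] f (r *\<^sub>R e) / r"
    if b: "b \<in> Basis" "b \<noteq> e" for b
  proof -
    define \<rho> where "\<rho> t = sqrt (r\<^sup>2 + t\<^sup>2)" for t
    have pos: "r\<^sup>2 + t\<^sup>2 > 0" for t
      using \<open>r > 0\<close> by (simp add: add_pos_nonneg)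
    have norm_eq: "norm (r *\<^sub>R e + t *\<^sub>R b) = norm (\<rho> t *\<^sub>R e)" for t
    proof -
      have "(norm (r *\<^sub>R e + t *\<^sub>R b))\<^sup>2 = r\<^sup>2 + t\<^sup>2"
        using e b by (subst norm_add_Pythagorean) (auto simp: orthogonal_def inner_not_same_Basis)
      then show ?thesis
        using e pos[of t] by (simp add: \<rho>_def real_sqrt_unique)
    qed
    have f_eq: "f (r *\<^sub>R e + t *\<^sub>R b) = f (\<rho> t *\<^sub>R e)" for t
      using \<open>radial f\<close> norm_eq unfolding radial_def by blast
    have d\<rho>: "(\<rho> has_real_derivative t / \<rho> t) (at t)" for t
      unfolding \<rho>_def[abs_def]
      by (rule DERIV_cong, rule DERIV_chain2[where f = sqrt], rule DERIV_real_sqrt, rule pos,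
          (rule derivative_eq_intros refl)+)
        (simp add: field_simps)
    have "((\<lambda>t. f (\<rho> t *\<^sub>R e)) has_real_derivative
        iter_partial [e] f (\<rho> t *\<^sub>R e) * (t / \<rho> t)) (at t)" for t
      using DERIV_chain2[OF smooth_iter_partial_has_derivative[OF \<open>smooth f\<close>, of "[]" e 0] d\<rho>] e
      by simp
    moreover have "((\<lambda>t. f (r *\<^sub>R e + t *\<^sub>R b)) has_real_derivative
        iter_partial [b] f (r *\<^sub>R e + t *\<^sub>R b)) (at t)" for t
      using smooth_iter_partial_has_derivative[OF \<open>smooth f\<close>, of "[]" b] b by simp
    \<comment> \<open>Known for all \<open>t\<close>, so it can be differentiated again; at t = 0
      the factor t / \<rho> kills the term with the second derivative of f.\<close>
    ultimately have first: "iter_partial [b] f (r *\<^sub>R e + t *\<^sub>R b)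
        = iter_partial [e] f (\<rho> t *\<^sub>R e) * (t / \<rho> t)" for t
      using DERIV_unique by (fastforce simp: f_eq)
    have "((\<lambda>t. iter_partial [e] f (\<rho> t *\<^sub>R e)) has_real_derivative
        iter_partial [e, e] f (\<rho> 0 *\<^sub>R e) * (0 / \<rho> 0)) (at 0)"
      using DERIV_chain2[OF smooth_iter_partial_has_derivative[OF \<open>smooth f\<close>, of "[e]" e 0] d\<rho>[of 0]] e
      by simp
    moreover have "((\<lambda>t. t / \<rho> t) has_real_derivative 1 / r) (at 0)"
      using \<open>r > 0\<close>
      by (auto intro!: derivative_eq_intros d\<rho> simp: \<rho>_def)
    ultimately have "((\<lambda>t. iter_partial [e] f (\<rho> t *\<^sub>R e) * (t / \<rho> t)) has_real_derivative
        iter_partial [e] f (r *\<^sub>R e) / r) (at 0)"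
      using \<open>r > 0\<close> by (auto dest: DERIV_mult simp: \<rho>_def)
    then have "deriv (\<lambda>t. iter_partial [b] f (r *\<^sub>R e + t *\<^sub>R b)) 0 = iter_partial [e] f (r *\<^sub>R e) / r"
      unfolding first by (rule DERIV_imp_deriv)
    then show ?thesis
      by (simp add: partial_deriv_def[of b "partial_deriv b f"])
  qed
  have "laplacian f (r *\<^sub>R e) = iter_partial [e, e] f (r *\<^sub>R e)
      + (\<Sum>b\<in>Basis - {e}. iter_partial [e] f (r *\<^sub>R e) / r)"
    unfolding laplacian_def using e tangential by (simp add: sum.remove[of Basis e])
  then show ?thesis
    using e by (simp add: card_Diff_singleton of_nat_diff Suc_leI)
qed

lemma schwartz_ray_decay:
  assumes "schwartz f" "bs \<in> lists Basis" "e \<in> Basis"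
  shows "\<exists>C. \<forall>r>0. r ^ k * \<bar>iter_partial bs f (r *\<^sub>R e)\<bar> \<le> C"
proof -
  obtain C where C: "\<And>x. norm x ^ k * \<bar>iter_partial bs f x\<bar> \<le> C"
    using assms unfolding schwartz_def by metis
  have "r ^ k * \<bar>iter_partial bs f (r *\<^sub>R e)\<bar> \<le> C" if "r > 0" for r
    using C[of "r *\<^sub>R e"] \<open>e \<in> Basis\<close> that by simp
  then show ?thesis by blast
qed

text \<open>Radiality carries every nonzero point to the ray; the origin follows by
  continuity.\<close>

lemma radial_zero_if_zero_on_ray:
  fixes f :: "'a::euclidean_space \<Rightarrow> real"
  assumes "smooth f" "radial f" "e \<in> Basis" "\<And>r. r > 0 \<Longrightarrow> f (r *\<^sub>R e) = 0"
  shows "f = (\<lambda>x. 0)"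
proof
  fix x :: 'a
  have "f (norm x *\<^sub>R e) = 0"
  proof (cases "x = 0")
    case True
    have "isCont (\<lambda>t. f (0 + t *\<^sub>R e)) 0"
      using smooth_iter_partial_has_derivative[OF \<open>smooth f\<close>, of "[]" e 0 0] \<open>e \<in> Basis\<close>
      by (auto intro: DERIV_isCont)
    then have "((\<lambda>t. f (t *\<^sub>R e)) \<longlongrightarrow> f 0) (at_right 0)"
      by (simp add: isCont_def filterlim_at_split)
    moreover have "((\<lambda>t. f (t *\<^sub>R e)) \<longlongrightarrow> 0) (at_right 0)"
      by (rule tendsto_eventually) (auto simp: eventually_at_right_field assms intro!: exI[of _ 1])
    ultimately show ?thesis
      using True tendsto_unique trivial_limit_at_right_real by fastforce
  qed (use assms in auto)
  moreover have "norm (norm x *\<^sub>R e) = norm x"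
    using \<open>e \<in> Basis\<close> by simp
  ultimately show "f x = 0"
    using \<open>radial f\<close> unfolding radial_def by metis
qed

section \<open>Reduction of the eigenvalue problem to the radial system\<close>

theorem mainTheorem4:
  fixes \<nu> :: real
  assumes "\<nu> > 0"
    and "\<exists>Y1 Y2 :: real ^ 6 \<Rightarrow> real.
      schwartz Y1 \<and> radial Y1 \<and> Y1 \<noteq> (\<lambda>x. 0) \<and>
      schwartz Y2 \<and> radial Y2 \<and> Y2 \<noteq> (\<lambda>x. 0) \<and>
      (\<forall>x. Lplus Y1 x = - \<nu> * Y2 x) \<and>
      (\<forall>x. Lminus Y2 x = \<nu> * Y1 x)"
  shows "\<nu> \<le> 1 / 4"
proof (rule ccontr)
  assume "\<not> \<nu> \<le> 1 / 4"
  then have \<nu>: "\<nu> > 1 / 4" by simp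
  obtain Y1 Y2 :: "real ^ 6 \<Rightarrow> real"
    where Y1: "schwartz Y1" "radial Y1" "Y1 \<noteq> (\<lambda>x. 0)"
      and Y2: "schwartz Y2" "radial Y2"
      and eq1: "\<And>x. Lplus Y1 x = - \<nu> * Y2 x"
      and eq2: "\<And>x. Lminus Y2 x = \<nu> * Y1 x"
    using assms(2) by blast
  have smooth: "smooth Y1" "smooth Y2"
    using Y1 Y2 by (auto simp: schwartz_def)
  obtain e :: "real ^ 6" where e: "e \<in> Basis"
    using nonempty_Basis by blast
  \<comment> \<open>Prepending \<open>e\<close> to \<open>bs\<close> differentiates the profile, so
    \<open>[]\<close>, \<open>[e]\<close>, \<open>[e, e]\<close> give the function and its first two
    radial derivatives.\<close>
  define ray where "ray bs f r = iter_partial bs f (r *\<^sub>R e)" for bs f r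
  have d: "(ray bs f has_real_derivative ray (e # bs) f r) (at r)"
    if "smooth f" "bs \<in> lists Basis" for f bs r
    using smooth_iter_partial_has_derivative[OF that e, of 0 r] by (simp add: ray_def[abs_def])
  have W_ray: "W (r *\<^sub>R e) = (w r)\<^sup>2" for r
    using e by (simp add: W_def w_def power_divide)
  have laplacian_ray: "laplacian f (r *\<^sub>R e) = ray [e, e] f r + 5 / r * ray [e] f r"
    if "smooth f" "radial f" "r > 0" for f r
    using radial_laplacian[OF that(1,2) e that(3)] by (simp add: ray_def)
  have ray_decay: "\<exists>C. \<forall>r>0. r ^ k * \<bar>ray bs f r\<bar> \<le> C"
    if "schwartz f" "bs \<in> lists Basis" for f bs k
    using schwartz_ray_decay[OF that e] by (simp add: ray_def)
  have "ray [] Y1 r = 0" if "r > 0" for r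
  proof (rule decaying_radial_solution_zero[OF \<nu>, of "ray [] Y1" "ray [e] Y1" "ray [e, e] Y1"
        "ray [] Y2" "ray [e] Y2" "ray [e, e] Y2"])
    show "\<exists>C. \<forall>r>0. r ^ k * \<bar>f r\<bar> \<le> C"
      if "f \<in> {ray [] Y1, ray [e] Y1, ray [] Y2, ray [e] Y2}" for f k
      using that ray_decay[OF Y1(1)] ray_decay[OF Y2(1)] e by (elim insertE emptyE) simp_all
    show "- (ray [e, e] Y1 s + 5 / s * ray [e] Y1 s) - 2 * (w s)\<^sup>2 * ray [] Y1 s = - \<nu> * ray [] Y2 s"
      if "s > 0" for s
      using eq1[of "s *\<^sub>R e"] laplacian_ray[OF smooth(1) Y1(2) that]
      by (simp add: Lplus_def W_ray ray_def)
    show "- (ray [e, e] Y2 s + 5 / s * ray [e] Y2 s) - (w s)\<^sup>2 * ray [] Y2 s = \<nu> * ray [] Y1 s"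
      if "s > 0" for s
      using eq2[of "s *\<^sub>R e"] laplacian_ray[OF smooth(2) Y2(2) that]
      by (simp add: Lminus_def W_ray ray_def)
  qed (use that e smooth in \<open>auto intro!: d\<close>)
  then have "Y1 = (\<lambda>x. 0)"
    using radial_zero_if_zero_on_ray[OF smooth(1) Y1(2) e] by (simp add: ray_def)
  with Y1(3) show False by simp
qed

end
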